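(* Let $\Pi$ be a complex analytic manifold in a vector space $\mathcal{U}$ that is isometrically isomorphic to $\mathbb{C}^n$. There is a tubular neighborhood of $\Pi$, namely an open subset $\Omega\supset\Pi$ of $\mathcal{U}$ such that every $\mathbf{b}\in\Omega$ has a unique projection $\mathbf{x}_{\mathbf{b}}\in\Pi$ of minimum distance to $\mathbf{b}$, that is, $$\|\mathbf{x}_{\mathbf{b}}-\mathbf{b}\|=\inf_{\mathbf{x}\in\Pi}\|\mathbf{x}-\mathbf{b}\|.$$ Furthermore, the projection $\mathbf{b}\mapsto\mathbf{x}_{\mathbf{b}}$ from $\Omega$ to $\Pi$ is locally Lipschitz continuous.
   Context: $\mathbb{C}^n$ carries the Euclidean norm $\|\cdot\|_2$; $\mathcal{U}$ is a normed vector space over $\mathbb{C}$ with a norm-preserving linear isomorphism onto $\mathbb{C}^n$. A mapping from an open subset of a finite-dimensional complex vector space to another is holomorphic if its coordinate representation is holomorphic. A mapping on a non-open set $S$ is holomorphic if it is the restriction to $S$ of a holomorphic mapping defined on an open set containing $S$. Complex analytic manifold: a subset $\Pi$ of a finite-dimensional normed vector space $\mathcal{U}$ over $\mathbb{C}$ is a complex analytic manifold of dimension $m$ if there is an $m$-dimensional normed vector space $\mathcal{V}$ over $\mathbb{C}$ and, for every $\mathbf{u}\in\Pi$, there is an open neighborhood $\Sigma$ of $\mathbf{u}$ in $\mathcal{U}$ and a holomorphic mapping $\phi$ from $\Sigma\cap\Pi$ onto an open subset $\Lambda$ of $\mathcal{V}$ with a holomorphic inverse. *)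

theory Defs
  imports "HOL-Analysis.Analysis"
begin

class complex_normed_vector = real_normed_vector +
  fixes scaleC :: "complex \<Rightarrow> 'a \<Rightarrow> 'a"  (infixr "*\<^sub>C" 75)
  assumes scaleC_add_right: "a *\<^sub>C (x + y) = a *\<^sub>C x + a *\<^sub>C y"
    and scaleC_add_left: "(a + b) *\<^sub>C x = a *\<^sub>C x + b *\<^sub>C x"
    and scaleC_scaleC: "a *\<^sub>C b *\<^sub>C x = (a * b) *\<^sub>C x"
    and scaleC_of_real: "complex_of_real r *\<^sub>C x = r *\<^sub>R x"
    and norm_scaleC: "norm (a *\<^sub>C x) = cmod a * norm x"

interpretation complex_vector:
  vector_space "scaleC :: complex \<Rightarrow> 'a \<Rightarrow> 'a::complex_normed_vector"
proof unfold_locales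
  show "1 *\<^sub>C x = x" for x :: 'a
    using scaleC_of_real [of 1 x] by simp
qed (simp_all add: scaleC_add_right scaleC_add_left scaleC_scaleC)

instantiation complex :: complex_normed_vector
begin

definition scaleC_complex :: "complex \<Rightarrow> complex \<Rightarrow> complex" where
  "scaleC_complex a x = a * x"

instance
  by standard (simp_all add: scaleC_complex_def algebra_simps norm_mult scaleR_conv_of_real)

end

instantiation vec :: (complex_normed_vector, finite) complex_normed_vector
begin

definition scaleC_vec :: "complex \<Rightarrow> 'a ^ 'b \<Rightarrow> 'a ^ 'b" where
  "scaleC_vec a x = (\<chi> i. a *\<^sub>C x $ i)"

instance
proof
  show "norm (a *\<^sub>C x) = cmod a * norm x" for a and x :: "'a ^ 'b"
    by (simp add: norm_vec_def scaleC_vec_def norm_scaleC L2_set_right_distrib)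
qed (simp_all add: scaleC_vec_def vec_eq_iff scaleC_add_right scaleC_add_left
       scaleC_scaleC scaleC_of_real)

end

text \<open>
  Here \<open>'n\<close> indexes the coordinates; the library norm on \<open>complex ^ 'n\<close> is the Euclidean norm.
\<close>
definition isometric_isomorphism ::
    "('a::complex_normed_vector \<Rightarrow> complex ^ 'n::finite) \<Rightarrow> bool" where
  "isometric_isomorphism T \<longleftrightarrow>
     Vector_Spaces.linear scaleC scaleC T \<and> bij T \<and> (\<forall>x. norm (T x) = norm x)"

definition complex_basis :: "'a::complex_normed_vector set \<Rightarrow> bool" where
  "complex_basis B \<longleftrightarrow> finite_dimensional_vector_space (scaleC :: complex \<Rightarrow> 'a \<Rightarrow> 'a) B"

text \<open>
  Scalar functions of finitely many complex variables \<open>z i\<close>, \<open>i \<in> I\<close>, on an open set \<open>W\<close>: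
  holomorphic means continuous and holomorphic in each variable separately.
\<close>
definition holomorphic_in_variables ::
    "'i set \<Rightarrow> (('i \<Rightarrow> complex) \<Rightarrow> complex) \<Rightarrow> ('i \<Rightarrow> complex) set \<Rightarrow> bool" where
  "holomorphic_in_variables I g W \<longleftrightarrow>
     continuous_on W g \<and>
     (\<forall>z\<in>W. \<forall>i\<in>I. (\<lambda>\<zeta>. g (z(i := \<zeta>))) holomorphic_on {\<zeta>. z(i := \<zeta>) \<in> W})"

text \<open>
  The coordinate representation of \<open>f\<close> with respect to bases \<open>B\<close> and \<open>C\<close>. Coordinate vectors are
  indexed by the basis elements themselves; the values of \<open>z\<close> outside \<open>B\<close> are irrelevant.
\<close>
definition coordinate_point ::
    "'a::complex_normed_vector set \<Rightarrow> ('a \<Rightarrow> complex) \<Rightarrow> 'a" where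
  "coordinate_point B z = (\<Sum>b\<in>B. z b *\<^sub>C b)"

definition coordinate_rep ::
    "'a::complex_normed_vector set \<Rightarrow> 'b::complex_normed_vector set \<Rightarrow> ('a \<Rightarrow> 'b) \<Rightarrow>
     ('a \<Rightarrow> complex) \<Rightarrow> 'b \<Rightarrow> complex" where
  "coordinate_rep B C f z = complex_vector.representation C (f (coordinate_point B z))"

definition holomorphic_map_open ::
    "'a::complex_normed_vector set \<Rightarrow> ('a \<Rightarrow> 'b::complex_normed_vector) \<Rightarrow> bool" where
  "holomorphic_map_open S f \<longleftrightarrow>
     open S \<and>
     (\<exists>B C. complex_basis B \<and> complex_basis C \<and>
       (\<forall>c\<in>C. holomorphic_in_variables B (\<lambda>z. coordinate_rep B C f z c)
                {z. coordinate_point B z \<in> S}))"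

definition holomorphic_map ::
    "'a::complex_normed_vector set \<Rightarrow> ('a \<Rightarrow> 'b::complex_normed_vector) \<Rightarrow> bool" where
  "holomorphic_map S f \<longleftrightarrow>
     (\<exists>W g. S \<subseteq> W \<and> holomorphic_map_open W g \<and> (\<forall>x\<in>S. g x = f x))"

text \<open>
  The model space is the type \<open>'v\<close>. It may be zero-dimensional.
\<close>
definition complex_analytic_manifold ::
    "'v::complex_normed_vector itself \<Rightarrow> nat \<Rightarrow> 'u::complex_normed_vector set \<Rightarrow> bool" where
  "complex_analytic_manifold V m M \<longleftrightarrow>
     (\<exists>B::'v set. complex_basis B \<and> card B = m) \<and>
     (\<forall>u\<in>M. \<exists>S (\<phi> :: 'u \<Rightarrow> 'v) \<Lambda>.
        open S \<and> u \<in> S \<and> open \<Lambda> \<and>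
        bij_betw \<phi> (S \<inter> M) \<Lambda> \<and>
        holomorphic_map (S \<inter> M) \<phi> \<and>
        holomorphic_map \<Lambda> (inv_into (S \<inter> M) \<phi>))"

definition is_projection :: "'a::real_normed_vector set \<Rightarrow> 'a \<Rightarrow> 'a \<Rightarrow> bool" where
  "is_projection M b x \<longleftrightarrow> x \<in> M \<and> norm (x - b) = (INF y\<in>M. norm (y - b))"

definition locally_lipschitz_on ::
    "'a::metric_space set \<Rightarrow> ('a \<Rightarrow> 'b::metric_space) \<Rightarrow> bool" where
  "locally_lipschitz_on S f \<longleftrightarrow>
     (\<forall>b\<in>S. \<exists>\<epsilon>>0. \<exists>L. L-lipschitz_on (ball b \<epsilon> \<inter> S) f)"

end

theory Submission
  imports Defs "HOL-Complex_Analysis.Conformal_Mappings"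
begin

text \<open>
  A tubular neighborhood exists around any subset of a Euclidean space that is locally closed and
  whose nearest points satisfy a quadratic estimate: near each of its points there is a constant
  \<open>C\<close> such that \<open>(b - x) \<bullet> (y - x) \<le> C * norm (b - x) * (norm (y - x))\<^sup>2\<close> for all nearby points
  \<open>x\<close>, \<open>y\<close> of the set and every \<open>b\<close> that has \<open>x\<close> as a nearest point. Local compactness yields a
  nearest point. If \<open>x\<close> and \<open>x'\<close> are nearest to \<open>b\<close> and \<open>b'\<close>, and both distances are so small
  that the right-hand side is at most a quarter of \<open>(norm (y - x))\<^sup>2\<close>, then adding the estimates
  for \<open>(x, x')\<close> and \<open>(x', x)\<close> and applying the Cauchy--Schwarz inequality gives
  \<open>dist x x' \<le> 2 * dist b b'\<close>. The case \<open>b = b'\<close> is uniqueness, and the general case is the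
  Lipschitz bound. This is \<open>tubular_neighborhood_if_quadratic_estimate\<close>, which is in essence
  Federer's argument about sets of positive reach.

  The estimate says that \<open>b - x\<close> is normal to the manifold at \<open>x\<close> and that the manifold deviates
  from its tangent space to second order. For a complex manifold both facts follow from function
  theory in one variable, so that tangent spaces and second derivatives do not appear. Two nearby
  points \<open>x\<close>, \<open>y\<close> lie on a holomorphic disc in the manifold: if \<open>h\<close> is the inverse of a chart
  \<open>g\<close>, then \<open>\<gamma> t = h (g x + t (g y - g x))\<close> runs from \<open>x\<close> at \<open>t = 0\<close> to \<open>y\<close> at \<open>t = 1\<close> and
  stays in the manifold and bounded for \<open>\<bar>t\<bar> < R\<close>, where \<open>1 / R\<close> is at most a multiple of
  \<open>norm (y - x)\<close> because \<open>g\<close> is Lipschitz (\<open>complex_analytic_manifold_discs\<close>). The Hermitian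
  product \<open>f t\<close> of \<open>\<gamma> t - x\<close> with \<open>b - x\<close> is a holomorphic function with \<open>f 0 = 0\<close>. Minimality of
  the distance from \<open>b\<close> to \<open>\<gamma> t\<close> at \<open>t = 0\<close> forces \<open>2 * Re (f t) \<le> (norm (\<gamma> t - x))\<^sup>2\<close>, which is
  of second order in \<open>t\<close>, and hence \<open>f\<close> vanishes to second order. Two applications of the Schwarz
  lemma bound \<open>\<bar>f 1\<bar>\<close> by a multiple of \<open>norm (b - x) / R\<^sup>2\<close>, which is the estimate
  (\<open>nearest_point_disc_estimate\<close>).

  Holomorphic maps are given here by coordinate functions that are continuous and holomorphic in
  each variable separately. Their restriction to a complex line is holomorphic by Osgood's lemma
  (\<open>holomorphic_in_variables_on_line\<close>), and the Schwarz lemma on such lines makes them locally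
  Lipschitz.
\<close>

section \<open>Coordinates in finite-dimensional complex normed spaces\<close>

lemma complex_basis_facts:
  fixes B :: "'a::complex_normed_vector set"
  assumes "complex_basis B"
  shows "finite B" "complex_vector.independent B" "complex_vector.span B = UNIV"
proof -
  interpret finite_dimensional_vector_space "scaleC :: complex \<Rightarrow> 'a \<Rightarrow> 'a" B
    using assms by (simp add: complex_basis_def)
  show "finite B" "complex_vector.independent B" "complex_vector.span B = UNIV"
    by (rule finite_Basis independent_Basis span_Basis)+
qed

lemma coordinate_point_representation:
  assumes "complex_basis B"
  shows "coordinate_point B (complex_vector.representation B x) = x"
  unfolding coordinate_point_def
  using complex_basis_facts[OF assms] by (intro complex_vector.sum_representation_eq) auto

lemma bounded_bilinear_scaleC:
  "bounded_bilinear (scaleC :: complex \<Rightarrow> 'a \<Rightarrow> 'a::complex_normed_vector)"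
proof
  show "\<exists>K. \<forall>a x. norm (a *\<^sub>C x :: 'a) \<le> norm a * norm x * K"
    by (rule exI[of _ 1]) (simp add: norm_scaleC)
next
  fix r a and x :: 'a
  show "(r *\<^sub>R a) *\<^sub>C x = r *\<^sub>R (a *\<^sub>C x)"
    by (simp add: scaleC_scaleC scaleR_conv_of_real flip: scaleC_of_real)
  show "a *\<^sub>C (r *\<^sub>R x) = r *\<^sub>R (a *\<^sub>C x)"
    by (simp add: scaleC_scaleC mult.commute flip: scaleC_of_real)
qed (simp_all add: scaleC_add_right scaleC_add_left)

lemmas continuous_on_scaleC [continuous_intros] =
  bounded_bilinear.continuous_on[OF bounded_bilinear_scaleC]

lemma continuous_on_coordinate_point: "continuous_on S (coordinate_point B)"
proof -
  have "continuous_on S (\<lambda>z :: 'a \<Rightarrow> complex. z b)" for b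
    by (rule continuous_on_subset[OF continuous_on_product_coordinates]) simp
  then show ?thesis
    unfolding coordinate_point_def
    by (intro continuous_on_sum continuous_on_scaleC continuous_on_const)
qed

lemma coordinate_point_eq_0D:
  assumes "complex_basis B" "coordinate_point B z = 0" "b \<in> B"
  shows "z b = 0"
  using complex_vector.independentD[of B B z b] complex_basis_facts[OF assms(1)] assms(2,3)
  by (auto simp: coordinate_point_def)

lemma coordinate_point_scaleR:
  "coordinate_point B (\<lambda>b. of_real r * z b) = r *\<^sub>R coordinate_point B z"
  by (simp add: coordinate_point_def complex_vector.scale_sum_right flip: scaleC_scaleC scaleC_of_real)

text \<open>
  Only finitely many coordinates matter, but the box lives in the space of all functions on the type;
  its compactness is Tychonoff's theorem, whatever the cardinality of that type.
\<close>
lemma compact_complex_box: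
  "compact {z :: 'a \<Rightarrow> complex. (\<forall>b\<in>B. cmod (z b) \<le> 1) \<and> (\<forall>b. b \<notin> B \<longrightarrow> z b = 0)}"
proof -
  have "{z :: 'a \<Rightarrow> complex. (\<forall>b\<in>B. cmod (z b) \<le> 1) \<and> (\<forall>b. b \<notin> B \<longrightarrow> z b = 0)}
      = PiE UNIV (\<lambda>b. if b \<in> B then cball 0 1 else {0})"
    by (auto simp: PiE_UNIV_domain Pi_iff if_split_mem2)
  moreover have "compactin (product_topology (\<lambda>_. euclidean) (UNIV :: 'a set))
      (PiE UNIV (\<lambda>b. if b \<in> B then cball 0 1 else {0 :: complex}))"
    by (auto simp: compactin_PiE)
  ultimately show ?thesis
    by (simp add: euclidean_product_topology)
qed

text \<open>
  All norms on a finite-dimensional space are equivalent: the norm of \<open>coordinate_point B z\<close> has a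
  positive minimum \<open>d\<close> over the compact set \<open>Z\<close> of coordinate vectors with \<open>\<Sum>b\<in>B. cmod (z b) = 1\<close>,
  and scaling turns \<open>d\<close> into the constant \<open>1 / d\<close>.
\<close>
lemma representation_bounded:
  fixes B :: "'a::complex_normed_vector set"
  assumes B: "complex_basis B"
  obtains K where "K > 0" "\<And>x b. cmod (complex_vector.representation B x b) \<le> K * norm x"
proof -
  let ?R = "complex_vector.representation B"
  define Z where "Z = {z :: 'a \<Rightarrow> complex. (\<forall>b\<in>B. cmod (z b) \<le> 1) \<and> (\<forall>b. b \<notin> B \<longrightarrow> z b = 0)}
      \<inter> {z. (\<Sum>b\<in>B. cmod (z b)) = 1}"
  have fin: "finite B"
    by (rule complex_basis_facts[OF B])
  have "closed {z :: 'a \<Rightarrow> complex. (\<Sum>b\<in>B. cmod (z b)) = 1}"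
    by (intro closed_Collect_eq continuous_intros continuous_on_product_coordinates)
  then have "compact Z"
    unfolding Z_def by (rule compact_Int_closed[OF compact_complex_box])
  have nz: "coordinate_point B z \<noteq> 0" if "z \<in> Z" for z
  proof
    assume "coordinate_point B z = 0"
    then have "(\<Sum>b\<in>B. cmod (z b)) = 0"
      using coordinate_point_eq_0D[OF B] by (auto intro!: sum.neutral)
    then show False
      using that by (simp add: Z_def)
  qed
  obtain d where d: "d > 0" "\<And>z. z \<in> Z \<Longrightarrow> d \<le> norm (coordinate_point B z)"
  \<comment> \<open>The set \<open>Z\<close> is empty exactly if the space is zero-dimensional.\<close>
  proof (cases "Z = {}")
    case False
    then obtain z0 where "z0 \<in> Z"
        "\<forall>z\<in>Z. norm (coordinate_point B z0) \<le> norm (coordinate_point B z)"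
      using continuous_attains_inf[OF \<open>compact Z\<close>, of "\<lambda>z. norm (coordinate_point B z)"]
        continuous_on_norm[OF continuous_on_coordinate_point] by blast
    then show ?thesis
      using nz that[of "norm (coordinate_point B z0)"] by auto
  qed (use that[of 1] in auto)
  show ?thesis
  proof (rule that[of "1 / d"])
    fix x b
    define s where "s = (\<Sum>b\<in>B. cmod (?R x b))"
    have le_s: "cmod (?R x b) \<le> s" for b
    proof (cases "b \<in> B")
      case True
      then show ?thesis
        unfolding s_def by (intro member_le_sum) (use fin in auto)
    next
      case False
      then have "?R x b = 0"
        using complex_vector.representation_ne_zero by blast
      then show ?thesis
        by (simp add: s_def sum_nonneg)
    qed
    show "cmod (?R x b) \<le> 1 / d * norm x"
    proof (cases "s > 0")
      case False
      then have "cmod (?R x b) \<le> 0"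
        using le_s[of b] by linarith
      then show ?thesis
        using \<open>d > 0\<close> by simp
    next
      case True
      have "cmod (of_real (1 / s) * ?R x b) = cmod (?R x b) / s" for b
        using True by (simp add: norm_mult norm_divide)
      moreover have "(\<Sum>b\<in>B. cmod (?R x b) / s) = 1"
        using True by (simp add: s_def flip: sum_divide_distrib)
      ultimately have "(\<lambda>b. of_real (1 / s) * ?R x b) \<in> Z"
        using True le_s complex_vector.representation_ne_zero[of B x] by (auto simp: Z_def)
      then have "d \<le> norm ((1 / s) *\<^sub>R x)"
        using d(2) coordinate_point_scaleR[of B "1 / s" "?R x"]
          coordinate_point_representation[OF B] by metis
      then have "s \<le> 1 / d * norm x"
        using True \<open>d > 0\<close> by (simp add: field_simps)
      then show ?thesis
        using le_s[of b] by linarith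
    qed
  qed (use d in auto)
qed

lemma continuous_on_representation:
  assumes "complex_basis B"
  shows "continuous_on S (\<lambda>x. complex_vector.representation B x)"
proof (rule continuous_on_coordinatewise_then_product)
  fix b
  obtain K where K: "K > 0" "\<And>x b. cmod (complex_vector.representation B x b) \<le> K * norm x"
    using representation_bounded[OF assms] by blast
  have "K-lipschitz_on S (\<lambda>x. complex_vector.representation B x b)"
  proof (rule lipschitz_onI)
    fix x y
    show "dist (complex_vector.representation B x b) (complex_vector.representation B y b)
        \<le> K * dist x y"
      using K(2)[of "x - y" b] complex_basis_facts[OF assms]
      by (simp add: dist_norm complex_vector.representation_diff)
  qed (use K in simp)
  then show "continuous_on S (\<lambda>x. complex_vector.representation B x b)"
    by (rule lipschitz_on_continuous_on)
qed

section \<open>Quantitative forms of the Schwarz lemma\<close>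

text \<open>
  The Schwarz lemma for an arbitrary disc. It is applied to \<open>f / K\<close> for all \<open>K > B\<close>, since it
  requires the strict bound \<open>1\<close>; then \<open>K\<close> tends to \<open>B\<close>.
\<close>
lemma schwarz_bound:
  assumes f: "f holomorphic_on ball c R" and B: "\<And>z. z \<in> ball c R \<Longrightarrow> cmod (f z) \<le> B"
    and "f c = 0" and z: "z \<in> ball c R"
  shows "cmod (f z) \<le> B * (cmod (z - c) / R)"
proof -
  have "R > 0"
    using z by (simp add: le_less_trans[OF zero_le_dist])
  have "B \<ge> 0"
    using B[OF z] norm_ge_zero order_trans by blast
  have *: "cmod (f z) \<le> K * (cmod (z - c) / R)" if "B < K" for K
  proof -
    define g where "g w = f (c + of_real R * w) / of_real K" for w
    have in_ball: "c + of_real R * w \<in> ball c R" if "norm w < 1" for w :: complex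
      using that \<open>R > 0\<close> by (simp add: dist_norm norm_mult)
    have "(f \<circ> (\<lambda>w. c + of_real R * w)) holomorphic_on ball 0 1"
      using in_ball by (intro holomorphic_on_compose_gen[OF _ f] holomorphic_intros) auto
    then have "g holomorphic_on ball 0 1"
      unfolding g_def using \<open>B < K\<close> \<open>B \<ge> 0\<close> by (intro holomorphic_intros) (auto simp: o_def)
    moreover have "norm (g w) < 1" if "norm w < 1" for w
      using B[OF in_ball[OF that]] \<open>B < K\<close> \<open>B \<ge> 0\<close> by (simp add: g_def norm_divide)
    moreover have "g 0 = 0"
      using \<open>f c = 0\<close> by (simp add: g_def)
    moreover have "norm ((z - c) / of_real R) < 1"
      using z \<open>R > 0\<close> by (simp add: norm_divide dist_norm norm_minus_commute)
    ultimately have "norm (g ((z - c) / of_real R)) \<le> norm ((z - c) / of_real R)"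
      using Schwarz_Lemma(1)[of g] by blast
    then show ?thesis
      using \<open>R > 0\<close> \<open>B < K\<close> \<open>B \<ge> 0\<close> by (simp add: g_def norm_divide field_simps)
  qed
  have "((\<lambda>K. K * (cmod (z - c) / R)) \<longlongrightarrow> B * (cmod (z - c) / R)) (at_right B)"
    by (intro tendsto_intros)
  then show ?thesis
    by (rule tendsto_lowerbound)
      (use * in \<open>auto simp: eventually_at_right_less eventually_at_filter\<close>)
qed

lemma holomorphic_increment_bound:
  assumes f: "f holomorphic_on ball c R" and B: "\<And>z. z \<in> ball c R \<Longrightarrow> cmod (f z) \<le> B"
    and z: "z \<in> ball c R"
  shows "cmod (f z - f c) \<le> 2 * B * (cmod (z - c) / R)"
proof (rule schwarz_bound[of "\<lambda>z. f z - f c"])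
  show "cmod (f w - f c) \<le> 2 * B" if "w \<in> ball c R" for w
  proof -
    have "c \<in> ball c R"
      using z by (simp add: le_less_trans[OF zero_le_dist])
    then show ?thesis
      using B[OF that] B[of c] norm_triangle_ineq4[of "f w" "f c"] by simp
  qed
qed (use assms in \<open>auto intro!: holomorphic_intros\<close>)

text \<open>
  A function with a double zero at the centre is bounded quadratically: the Schwarz lemma for
  \<open>z * q z\<close> bounds \<open>q\<close> by \<open>B / R\<close>, and a second application to \<open>q\<close> gains the other factor. The
  double zero is expressed by the factorization, so that no derivative has to be computed.
\<close>
lemma schwarz_second_order:
  assumes q: "q holomorphic_on ball 0 R" and "q 0 = 0"
    and B: "\<And>z. z \<in> ball 0 R \<Longrightarrow> cmod (z * q z) \<le> B" and z: "z \<in> ball 0 R"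
  shows "cmod (z * q z) \<le> B * (cmod z / R)\<^sup>2"
proof -
  have "R > 0"
    using z by (simp add: le_less_trans[OF norm_ge_zero])
  have "B \<ge> 0"
    using B[OF z] norm_ge_zero order_trans by blast
  have "cmod (q w) \<le> B / R" if w: "w \<in> ball 0 R" for w
  proof (cases "w = 0")
    case False
    have "cmod (w * q w) \<le> B * (cmod (w - 0) / R)"
      by (rule schwarz_bound) (use B w in \<open>auto intro!: holomorphic_intros q\<close>)
    then show ?thesis
      using False \<open>R > 0\<close> by (simp add: norm_mult field_simps)
  qed (use \<open>B \<ge> 0\<close> \<open>R > 0\<close> \<open>q 0 = 0\<close> in simp)
  then have "cmod (q z) \<le> B / R * (cmod z / R)"
    using schwarz_bound[OF q _ \<open>q 0 = 0\<close> z, of "B / R"] by simp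
  then have "cmod z * cmod (q z) \<le> cmod z * (B / R * (cmod z / R))"
    by (rule mult_left_mono) simp
  then show ?thesis
    by (simp add: norm_mult power2_eq_square mult_ac)
qed

section \<open>Osgood's lemma\<close>

text \<open>
  The case of two variables of Osgood's lemma. The increment of \<open>G\<close> along the diagonal is the sum of
  its increments from \<open>(c, c)\<close> along both axes and the mixed difference \<open>E\<close>. For fixed \<open>s\<close>, the
  function \<open>w \<mapsto> G w s - G w c\<close> is holomorphic and uniformly small when \<open>s\<close> is close to \<open>c\<close>, so the
  Schwarz lemma bounds its increment \<open>E s\<close> by \<open>o(s - c)\<close>.
\<close>
lemma diagonal_holomorphic:
  fixes G :: "complex \<Rightarrow> complex \<Rightarrow> complex"
  assumes U: "open U" and cont: "continuous_on U (\<lambda>(s, t). G s t)"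
    and hol1: "\<And>t. (\<lambda>s. G s t) holomorphic_on {s. (s, t) \<in> U}"
    and hol2: "\<And>s. (\<lambda>t. G s t) holomorphic_on {t. (s, t) \<in> U}"
  shows "(\<lambda>s. G s s) holomorphic_on {s. (s, s) \<in> U}"
proof -
  have diff: "(\<lambda>s. G s s) field_differentiable at c" if cU: "(c, c) \<in> U" for c
  proof -
    obtain A1 A2 where A: "open A1" "open A2" "c \<in> A1" "c \<in> A2" "A1 \<times> A2 \<subseteq> U"
      using open_prod_elim[OF U cU] by (metis mem_Sigma_iff)
    obtain R where R: "R > 0" "cball c R \<subseteq> A1 \<inter> A2"
      using A open_contains_cball_eq[of "A1 \<inter> A2"] by blast
    have box: "cball c R \<times> cball c R \<subseteq> U"
      using A(5) R(2) by blast
    have hol1': "(\<lambda>s. G s t) holomorphic_on ball c R" if "t \<in> cball c R" for t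
      by (rule holomorphic_on_subset[OF hol1]) (use that box in auto)
    have hol2': "(\<lambda>t. G s t) holomorphic_on ball c R" if "s \<in> cball c R" for s
      by (rule holomorphic_on_subset[OF hol2]) (use that box in auto)
    have c: "c \<in> ball c R" "c \<in> cball c R"
      using R(1) by auto
    obtain D1 where D1: "((\<lambda>s. G s c) has_field_derivative D1) (at c)"
      using hol1'[OF c(2)] c(1) holomorphic_derivI open_ball by blast
    obtain D2 where D2: "((\<lambda>t. G c t) has_field_derivative D2) (at c)"
      using hol2'[OF c(2)] c(1) holomorphic_derivI open_ball by blast
    define E where "E s = (G s s - G s c) - (G c s - G c c)" for s
    have "uniformly_continuous_on (cball c R \<times> cball c R) (\<lambda>(s, t). G s t)"
      by (intro compact_uniformly_continuous continuous_on_subset[OF cont box]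
          compact_Times compact_cball)
    then have unif: "\<exists>d>0. \<forall>s t. s \<in> cball c R \<longrightarrow> t \<in> cball c R \<longrightarrow> dist t c < d \<longrightarrow>
        cmod (G s t - G s c) < e" if "e > 0" for e
      using that c(2) by (fastforce simp: uniformly_continuous_on_def dist_Pair_Pair dist_norm
          dest!: spec[of _ e])
    have "((\<lambda>s. E s / (s - c)) \<longlongrightarrow> 0) (at c)"
    proof (rule LIM_I)
      fix e :: real
      assume "e > 0"
      \<comment> \<open>The Schwarz lemma costs a factor \<open>2 / R\<close>; with \<open>5\<close> in place of \<open>2\<close> the final bound is strict.\<close>
      then have "e * R / 5 > 0"
        using R(1) by simp
      then obtain d where d: "d > 0" "\<And>s t. s \<in> cball c R \<Longrightarrow> t \<in> cball c R \<Longrightarrow> dist t c < d \<Longrightarrow>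
          cmod (G s t - G s c) < e * R / 5"
        using unif by meson
      have "norm (E s / (s - c) - 0) < e" if s: "s \<noteq> c \<and> norm (s - c) < min d R" for s
      proof -
        have s': "s \<in> ball c R" "s \<in> cball c R"
          using s by (auto simp: dist_norm norm_minus_commute)
        have "cmod (E s) \<le> 2 * (e * R / 5) * (cmod (s - c) / R)"
          unfolding E_def
          by (rule holomorphic_increment_bound[of "\<lambda>w. G w s - G w c"])
            (use d(2)[OF _ s'(2)] s s'(1) in \<open>auto intro!: holomorphic_intros hol1' s' c
                simp: dist_norm less_imp_le\<close>)
        moreover have "e * cmod (s - c) > 0"
          using s \<open>e > 0\<close> by simp
        ultimately have "cmod (E s) < e * cmod (s - c)"
          using R(1) by simp
        then show ?thesis
          using s by (simp add: norm_divide field_simps)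
      qed
      then show "\<exists>d>0. \<forall>s. s \<noteq> c \<and> norm (s - c) < d \<longrightarrow> norm (E s / (s - c) - 0) < e"
        using d(1) R(1) by (intro exI[of _ "min d R"]) auto
    qed
    then have "((\<lambda>s. E s / (s - c) + (G s c - G c c) / (s - c) + (G c s - G c c) / (s - c))
        \<longlongrightarrow> 0 + D1 + D2) (at c)"
      using D1 D2 by (intro tendsto_add) (simp_all add: has_field_derivative_iff)
    moreover have "E s / (s - c) + (G s c - G c c) / (s - c) + (G c s - G c c) / (s - c)
        = (G s s - G c c) / (s - c)" for s
      unfolding add_divide_distrib[symmetric] by (simp add: E_def)
    ultimately have "((\<lambda>s. G s s) has_field_derivative (0 + D1 + D2)) (at c)"
      by (simp add: has_field_derivative_iff)
    then show ?thesis
      using field_differentiable_def by blast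
  qed
  then show ?thesis
    by (auto simp: holomorphic_on_def intro: field_differentiable_at_within)
qed

text \<open>
  The variables in \<open>J\<close> are put on the line one after the other. When \<open>k\<close> joins \<open>J\<close>, let \<open>s\<close> be the
  parameter for \<open>k\<close> and \<open>t\<close> the parameter for the others: holomorphy in \<open>s\<close> is the hypothesis on \<open>g\<close>,
  holomorphy in \<open>t\<close> is the induction hypothesis, and the diagonal \<open>s = t\<close> is the new line.
\<close>
lemma holomorphic_in_variables_on_line:
  fixes g :: "('i \<Rightarrow> complex) \<Rightarrow> complex"
  assumes g: "holomorphic_in_variables I g W" and W: "open W" and J: "finite J" "J \<subseteq> I"
  shows "(\<lambda>\<zeta>. g (\<lambda>i. if i \<in> J then a i + \<zeta> * h i else z i)) holomorphic_on
           {\<zeta>. (\<lambda>i. if i \<in> J then a i + \<zeta> * h i else z i) \<in> W}"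
  using J
proof (induction J arbitrary: z rule: finite_induct)
  case empty
  then show ?case
    by simp
next
  case (insert k J)
  define p where "p s t i = (if i \<in> J then a i + t * h i else if i = k then a k + s * h k else z i)"
    for s t i
  define U where "U = {(s, t). p s t \<in> W}"
  have cont_p: "continuous_on UNIV (\<lambda>(s, t). p s t)"
  proof (rule continuous_on_coordinatewise_then_product)
    show "continuous_on UNIV (\<lambda>x. (case x of (s, t) \<Rightarrow> p s t) i)" for i
      by (cases "i \<in> J"; cases "i = k")
        (auto simp: p_def case_prod_unfold intro!: continuous_intros)
  qed
  have "open U"
    using open_vimage[OF W cont_p] by (simp add: U_def vimage_def case_prod_unfold)
  moreover have "continuous_on U (\<lambda>(s, t). g (p s t))"
  proof -
    have "continuous_on U (g \<circ> (\<lambda>(s, t). p s t))"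
      using g by (intro continuous_on_compose continuous_on_subset[OF cont_p])
        (auto simp: holomorphic_in_variables_def U_def elim!: continuous_on_subset)
    then show ?thesis
      by (simp add: o_def case_prod_unfold)
  qed
  moreover have "(\<lambda>s. g (p s t)) holomorphic_on {s. (s, t) \<in> U}" for t
  proof (cases "{s. (s, t) \<in> U} = {}")
    case False
    then obtain s0 where s0: "p s0 t \<in> W"
      by (auto simp: U_def)
    have upd: "p s t = (p s0 t)(k := a k + s * h k)" for s
      using insert.hyps by (auto simp: p_def fun_eq_iff)
    have "(\<lambda>\<zeta>. g ((p s0 t)(k := \<zeta>))) holomorphic_on {\<zeta>. (p s0 t)(k := \<zeta>) \<in> W}"
      using g s0 insert.prems by (auto simp: holomorphic_in_variables_def)
    then have "((\<lambda>\<zeta>. g ((p s0 t)(k := \<zeta>))) \<circ> (\<lambda>s. a k + s * h k)) holomorphic_on {s. (s, t) \<in> U}"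
      by (rule holomorphic_on_compose_gen[rotated])
        (auto simp: U_def intro!: holomorphic_intros simp flip: upd)
    then show ?thesis
      by (simp add: o_def flip: upd)
  qed (simp only: holomorphic_on_empty)
  moreover have "(\<lambda>t. g (p s t)) holomorphic_on {t. (s, t) \<in> U}" for s
  proof -
    have "p s t = (\<lambda>i. if i \<in> J then a i + t * h i else (z(k := a k + s * h k)) i)" for t
      by (auto simp: p_def fun_eq_iff)
    then show ?thesis
      using insert.IH[of "z(k := a k + s * h k)"] insert.prems by (simp add: U_def)
  qed
  ultimately have "(\<lambda>s. g (p s s)) holomorphic_on {s. (s, s) \<in> U}"
    by (rule diagonal_holomorphic)
  moreover have "p s s = (\<lambda>i. if i \<in> insert k J then a i + s * h i else z i)" for s
    using insert.hyps by (auto simp: p_def fun_eq_iff)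
  ultimately show ?case
    by (simp add: U_def)
qed

section \<open>Holomorphic maps between normed spaces\<close>

lemma holomorphic_map_openE:
  fixes f :: "'a::complex_normed_vector \<Rightarrow> 'b::complex_normed_vector"
  assumes "holomorphic_map_open W f"
  obtains B C where "open W" "complex_basis B" "complex_basis C"
    "\<And>c. c \<in> C \<Longrightarrow> holomorphic_in_variables B (\<lambda>z. coordinate_rep B C f z c)
        {z. coordinate_point B z \<in> W}"
  using assms unfolding holomorphic_map_open_def by blast

lemma continuous_on_holomorphic_map_open:
  assumes "holomorphic_map_open W f"
  shows "continuous_on W f"
proof -
  obtain B C where W: "open W" and B: "complex_basis B" and C: "complex_basis C"
    and hol: "\<And>c. c \<in> C \<Longrightarrow> holomorphic_in_variables B (\<lambda>z. coordinate_rep B C f z c)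
        {z. coordinate_point B z \<in> W}"
    by (rule holomorphic_map_openE[OF assms]) (rule that)
  have "continuous_on W (\<lambda>x. complex_vector.representation C (f x) c)" if "c \<in> C" for c
  proof -
    have "continuous_on W ((\<lambda>z. coordinate_rep B C f z c) \<circ> complex_vector.representation B)"
      using hol[OF that]
      by (intro continuous_on_compose continuous_on_representation[OF B])
        (auto simp: holomorphic_in_variables_def coordinate_point_representation[OF B]
          elim!: continuous_on_subset)
    then show ?thesis
      by (simp add: o_def coordinate_rep_def coordinate_point_representation[OF B])
  qed
  then have "continuous_on W (\<lambda>x. coordinate_point C (complex_vector.representation C (f x)))"
    unfolding coordinate_point_def by (intro continuous_intros)
  then show ?thesis
    by (simp add: coordinate_point_representation[OF C])
qed

text \<open>
  A linear functional of a vector is a fixed linear combination of its coordinates; composing with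
  functionals makes the statement independent of the bases and permits Hermitian products later.
\<close>
lemma holomorphic_map_open_on_line:
  fixes f :: "'a::complex_normed_vector \<Rightarrow> 'b::complex_normed_vector"
  assumes f: "holomorphic_map_open W f"
    and ell: "Vector_Spaces.linear scaleC (*) (l :: 'b \<Rightarrow> complex)"
  shows "(\<lambda>\<zeta>. l (f (p + \<zeta> *\<^sub>C q))) holomorphic_on {\<zeta>. p + \<zeta> *\<^sub>C q \<in> W}"
proof -
  obtain B C where W: "open W" and B: "complex_basis B" and C: "complex_basis C"
    and hol: "\<And>c. c \<in> C \<Longrightarrow> holomorphic_in_variables B (\<lambda>z. coordinate_rep B C f z c)
        {z. coordinate_point B z \<in> W}"
    by (rule holomorphic_map_openE[OF f]) (rule that)
  interpret l: Vector_Spaces.linear scaleC "(*)" l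
    by (rule ell)
  let ?z = "\<lambda>\<zeta> b. if b \<in> B then complex_vector.representation B p b
      + \<zeta> * complex_vector.representation B q b else 0"
  have point: "coordinate_point B (?z \<zeta>) = p + \<zeta> *\<^sub>C q" for \<zeta>
  proof -
    have "coordinate_point B (?z \<zeta>) = coordinate_point B (complex_vector.representation B p)
        + \<zeta> *\<^sub>C coordinate_point B (complex_vector.representation B q)"
      by (simp add: coordinate_point_def scaleC_add_left sum.distrib
          complex_vector.scale_sum_right)
    then show ?thesis
      by (simp add: coordinate_point_representation[OF B])
  qed
  have "open {z. coordinate_point B z \<in> W}"
    using open_vimage[OF W continuous_on_coordinate_point] by (simp add: vimage_def)
  from holomorphic_in_variables_on_line[OF hol this complex_basis_facts(1)[OF B] subset_refl,
      of _ "complex_vector.representation B p" "complex_vector.representation B q" "\<lambda>_. 0"]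
  have "(\<lambda>\<zeta>. complex_vector.representation C (f (p + \<zeta> *\<^sub>C q)) c)
      holomorphic_on {\<zeta>. p + \<zeta> *\<^sub>C q \<in> W}" if "c \<in> C" for c
    using that by (simp add: point coordinate_rep_def)
  then have "(\<lambda>\<zeta>. \<Sum>c\<in>C. complex_vector.representation C (f (p + \<zeta> *\<^sub>C q)) c * l c)
      holomorphic_on {\<zeta>. p + \<zeta> *\<^sub>C q \<in> W}"
    by (intro holomorphic_intros)
  moreover have "(\<Sum>c\<in>C. complex_vector.representation C x c * l c) = l x" for x
  proof -
    have "l (coordinate_point C (complex_vector.representation C x))
        = (\<Sum>c\<in>C. complex_vector.representation C x c * l c)"
      by (simp add: coordinate_point_def l.sum l.scale)
    then show ?thesis
      by (simp add: coordinate_point_representation[OF C])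
  qed
  ultimately show ?thesis
    by simp
qed

lemma linear_representation:
  assumes "complex_basis C"
  shows "Vector_Spaces.linear scaleC (*) (\<lambda>x. complex_vector.representation C x c)"
proof
qed (use complex_basis_facts[OF assms] in
  \<open>auto simp: complex_vector.representation_add complex_vector.representation_scale
    algebra_simps\<close>)

text \<open>
  Continuity bounds the coordinates of \<open>f\<close> by \<open>K * M\<close> on \<open>ball u d\<close>. If \<open>x\<close> and \<open>y\<close> lie in
  \<open>ball u (d / 4)\<close>, the complex line through them stays in \<open>ball u d\<close> for parameters up to
  \<open>R = d / (2 * norm (y - x)) > 1\<close>, so the Schwarz lemma bounds the increment from parameter \<open>0\<close> to
  parameter \<open>1\<close> by a multiple of \<open>1 / R\<close>.
\<close>
lemma holomorphic_map_open_locally_lipschitz: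
  fixes f :: "'a::complex_normed_vector \<Rightarrow> 'b::complex_normed_vector"
  assumes f: "holomorphic_map_open W f" and "u \<in> W"
  obtains r L where "r > 0" "L-lipschitz_on (ball u r) f"
proof -
  obtain C :: "'b set" where W: "open W" and C: "complex_basis C"
    by (rule holomorphic_map_openE[OF f]) (rule that)
  have finC: "finite C"
    by (rule complex_basis_facts[OF C])
  obtain K where K: "K > 0" "\<And>x b. cmod (complex_vector.representation C x b) \<le> K * norm x"
    using representation_bounded[OF C] by blast
  have "\<forall>\<^sub>F x in at u. x \<in> W \<and> norm (f x) < norm (f u) + 1"
  proof (rule eventually_conj)
    show "\<forall>\<^sub>F x in at u. x \<in> W"
      by (rule eventually_at_in_open'[OF W \<open>u \<in> W\<close>])
    have "(f \<longlongrightarrow> f u) (at u)"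
      using continuous_on_holomorphic_map_open[OF f] W \<open>u \<in> W\<close>
      by (simp add: continuous_on_eq_continuous_at isCont_def)
    then show "\<forall>\<^sub>F x in at u. norm (f x) < norm (f u) + 1"
      by (intro order_tendstoD(2)[OF tendsto_norm]) auto
  qed
  then obtain d where d: "d > 0" "\<And>x. x \<noteq> u \<Longrightarrow> dist x u < d \<Longrightarrow> x \<in> W \<and> norm (f x) < norm (f u) + 1"
    unfolding eventually_at by auto
  define M where "M = norm (f u) + 1"
  have dM: "x \<in> W" "norm (f x) \<le> M" if "dist x u < d" for x
    using d(2)[of x] that \<open>u \<in> W\<close> by (cases "x = u"; force simp: M_def)+
  define L where "L = (\<Sum>c\<in>C. 4 * (K * M) / d * norm c)"
  have "L-lipschitz_on (ball u (d / 4)) f"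
  proof (rule lipschitz_onI)
    fix x y
    assume x: "x \<in> ball u (d / 4)" and y: "y \<in> ball u (d / 4)"
    have comp: "cmod (complex_vector.representation C (f y - f x) c) \<le> 4 * (K * M) / d * norm (y - x)"
      for c
    proof (cases "y = x")
      case False
      define R where "R = d / 2 / norm (y - x)"
      have "norm (y - x) < d / 2"
        using dist_triangle_half_r[of u y "d / 2" x] x y by (simp add: dist_norm)
      then have "R > 1"
        using False by (simp add: R_def field_simps)
      have near: "dist (x + \<zeta> *\<^sub>C (y - x)) u < d" if "\<zeta> \<in> ball 0 R" for \<zeta>
      proof -
        have "norm (\<zeta> *\<^sub>C (y - x)) < d / 2"
          unfolding norm_scaleC using that False by (simp add: R_def field_simps)
        then show ?thesis
          using x d(1) norm_triangle_ineq[of "x - u" "\<zeta> *\<^sub>C (y - x)"]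
          by (simp add: dist_norm norm_minus_commute algebra_simps)
      qed
      let ?g = "\<lambda>\<zeta>. complex_vector.representation C (f (x + \<zeta> *\<^sub>C (y - x))) c"
      have "?g holomorphic_on ball 0 R"
        by (rule holomorphic_on_subset[OF holomorphic_map_open_on_line[OF f linear_representation[OF C]]])
          (use near dM in auto)
      moreover have "cmod (?g \<zeta>) \<le> K * M" if "\<zeta> \<in> ball 0 R" for \<zeta>
        using K(2) dM(2)[OF near[OF that]] K(1) by (meson mult_left_mono less_imp_le order_trans)
      moreover have "1 \<in> ball (0 :: complex) R"
        using \<open>R > 1\<close> by simp
      ultimately have "cmod (?g 1 - ?g 0) \<le> 2 * (K * M) * (cmod (1 - 0) / R)"
        by (rule holomorphic_increment_bound)
      then show ?thesis
        using complex_basis_facts[OF C] by (simp add: complex_vector.representation_diff R_def)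
    qed (use finC complex_vector.representation_zero[of C] in simp)
    have "norm (f y - f x) = norm (coordinate_point C (complex_vector.representation C (f y - f x)))"
      by (simp add: coordinate_point_representation[OF C])
    also have "\<dots> \<le> (\<Sum>c\<in>C. norm (complex_vector.representation C (f y - f x) c *\<^sub>C c))"
      unfolding coordinate_point_def by (rule norm_sum)
    also have "\<dots> \<le> (\<Sum>c\<in>C. 4 * (K * M) / d * norm (y - x) * norm c)"
      unfolding norm_scaleC by (intro sum_mono mult_right_mono comp norm_ge_zero)
    also have "\<dots> = L * norm (y - x)"
      by (simp add: L_def sum_distrib_left sum_distrib_right mult_ac)
    finally show "dist (f x) (f y) \<le> L * dist x y"
      by (simp add: dist_norm norm_minus_commute)
  next
    show "0 \<le> L"
      unfolding L_def M_def using K(1) d(1) by (intro sum_nonneg) simp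
  qed
  then show ?thesis
    using that[of "d / 4" L] d(1) by simp
qed

section \<open>Local structure of complex analytic manifolds\<close>

text \<open>
  A chart and its inverse, both replaced by holomorphic extensions \<open>g\<close>, \<open>h\<close> to open sets.
\<close>
lemma complex_analytic_manifold_chartE:
  fixes M :: "'u::complex_normed_vector set"
  assumes "complex_analytic_manifold TYPE('v::complex_normed_vector) m M" and "u \<in> M"
  obtains S \<Lambda> W and g :: "'u \<Rightarrow> 'v::complex_normed_vector" and W' h
  where "open S" "u \<in> S" "open \<Lambda>"
    "holomorphic_map_open W g" "S \<inter> M \<subseteq> W" "g ` (S \<inter> M) \<subseteq> \<Lambda>"
    "holomorphic_map_open W' h" "\<Lambda> \<subseteq> W'" "h ` \<Lambda> \<subseteq> S \<inter> M"
    "\<And>x. x \<in> S \<inter> M \<Longrightarrow> h (g x) = x"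
proof -
  obtain S and \<phi> :: "'u \<Rightarrow> 'v" and \<Lambda> where S: "open S" "u \<in> S" "open \<Lambda>"
    and bij: "bij_betw \<phi> (S \<inter> M) \<Lambda>" and hol: "holomorphic_map (S \<inter> M) \<phi>"
    "holomorphic_map \<Lambda> (inv_into (S \<inter> M) \<phi>)"
    using assms unfolding complex_analytic_manifold_def by blast
  obtain W g where g: "S \<inter> M \<subseteq> W" "holomorphic_map_open W g" "\<And>x. x \<in> S \<inter> M \<Longrightarrow> g x = \<phi> x"
    using hol(1) unfolding holomorphic_map_def by blast
  obtain W' h where h: "\<Lambda> \<subseteq> W'" "holomorphic_map_open W' h"
      "\<And>a. a \<in> \<Lambda> \<Longrightarrow> h a = inv_into (S \<inter> M) \<phi> a"
    using hol(2) unfolding holomorphic_map_def by blast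
  have \<phi>: "\<phi> x \<in> \<Lambda>" "inv_into (S \<inter> M) \<phi> (\<phi> x) = x" if "x \<in> S \<inter> M" for x
    using that bij_betwE[OF bij] bij_betw_inv_into_left[OF bij that] by auto
  have inv: "inv_into (S \<inter> M) \<phi> a \<in> S \<inter> M" if "a \<in> \<Lambda>" for a
    using that bij inv_into_into[of a \<phi> "S \<inter> M"] by (simp add: bij_betw_def)
  show ?thesis
  proof (rule that[of S \<Lambda> W g W' h])
    show "g ` (S \<inter> M) \<subseteq> \<Lambda>"
      using g(3) \<phi>(1) by (metis image_subsetI)
    show "h ` \<Lambda> \<subseteq> S \<inter> M"
      using h(3) inv by (metis image_subsetI)
    show "h (g x) = x" if "x \<in> S \<inter> M" for x
      using g(3)[OF that] h(3)[OF \<phi>(1)[OF that]] \<phi>(2)[OF that] by simp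
  qed (fact S g h)+
qed

text \<open>
  Near \<open>u\<close> the map \<open>h \<circ> g\<close> is a retraction onto \<open>M\<close>, so that \<open>M\<close> is the set of its fixed points, and
  that set is closed.
\<close>
lemma complex_analytic_manifold_locally_closed:
  fixes M :: "'u::complex_normed_vector set"
  assumes M: "complex_analytic_manifold TYPE('v::complex_normed_vector) m M" and u: "u \<in> M"
  obtains r where "r > 0" "closed (M \<inter> cball u r)"
proof -
  obtain S \<Lambda> W and g :: "'u \<Rightarrow> 'v" and W' h where "open S" "u \<in> S" "open \<Lambda>"
    and g: "holomorphic_map_open W g" "S \<inter> M \<subseteq> W" "g ` (S \<inter> M) \<subseteq> \<Lambda>"
    and h: "holomorphic_map_open W' h" "\<Lambda> \<subseteq> W'" "h ` \<Lambda> \<subseteq> S \<inter> M"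
    and hg: "\<And>x. x \<in> S \<inter> M \<Longrightarrow> h (g x) = x"
    by (rule complex_analytic_manifold_chartE[OF assms]) (rule that)
  have "open W"
    using g(1) by (simp add: holomorphic_map_open_def)
  have contg: "continuous_on W g"
    by (rule continuous_on_holomorphic_map_open[OF g(1)])
  define D where "D = S \<inter> (W \<inter> g -` \<Lambda>)"
  have "open D"
    unfolding D_def
    by (intro open_Int \<open>open S\<close> continuous_open_preimage[OF contg \<open>open W\<close> \<open>open \<Lambda>\<close>])
  moreover have "u \<in> D"
    using u \<open>u \<in> S\<close> g(2,3) by (auto simp: D_def)
  ultimately obtain r where r: "r > 0" "cball u r \<subseteq> D"
    using open_contains_cball_eq by blast
  have "continuous_on D (h \<circ> g)"
    by (intro continuous_on_compose continuous_on_subset[OF contg]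
        continuous_on_subset[OF continuous_on_holomorphic_map_open[OF h(1)]])
      (use h(2) in \<open>auto simp: D_def\<close>)
  then have "continuous_on (cball u r) (\<lambda>x. h (g x) - x)"
    by (intro continuous_intros continuous_on_subset[OF _ r(2)]) (simp add: o_def)
  then have "closed {x \<in> cball u r. h (g x) - x = 0}"
    by (rule continuous_closed_preimage_constant) simp
  moreover have "{x \<in> cball u r. h (g x) - x = 0} = M \<inter> cball u r"
  proof (intro set_eqI iffI)
    fix x
    assume x: "x \<in> {x \<in> cball u r. h (g x) - x = 0}"
    then have "g x \<in> \<Lambda>" "h (g x) = x"
      using r(2) by (auto simp: D_def)
    then have "x \<in> M"
      using h(3) by (metis Int_iff image_subset_iff)
    then show "x \<in> M \<inter> cball u r"
      using x by simp
  next
    fix x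
    assume "x \<in> M \<inter> cball u r"
    then show "x \<in> {x \<in> cball u r. h (g x) - x = 0}"
      using r(2) hg by (auto simp: D_def)
  qed
  ultimately show ?thesis
    using that r(1) by simp
qed

text \<open>
  The disc is the image under \<open>h\<close> of the complex line through \<open>g x\<close> and \<open>g y\<close>. The radius \<open>r\<close> is so
  small that \<open>g x\<close> and \<open>g y\<close> lie in the ball of radius \<open>\<rho> / 4\<close> about \<open>g u\<close>; the line then remains in
  the ball of radius \<open>\<rho>\<close> for parameters up to \<open>R = \<rho> / (2 * norm (g y - g x)) > 1\<close>. On that ball
  \<open>h\<close> is Lipschitz, which bounds the disc by a constant \<open>K\<close> independent of \<open>x\<close> and \<open>y\<close>.
\<close>
lemma complex_analytic_manifold_discs:
  fixes M :: "'u::complex_normed_vector set"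
  assumes M: "complex_analytic_manifold TYPE('v::complex_normed_vector) m M" and u: "u \<in> M"
  obtains r K L where "r > 0"
    "\<And>x y. x \<in> M \<inter> ball u r \<Longrightarrow> y \<in> M \<inter> ball u r \<Longrightarrow> x \<noteq> y \<Longrightarrow>
      \<exists>\<gamma> R. R > 1 \<and> 1 / R \<le> L * norm (y - x) \<and> \<gamma> 0 = x \<and> \<gamma> 1 = y \<and>
        (\<forall>t\<in>ball 0 R. \<gamma> t \<in> M \<and> norm (\<gamma> t - x) \<le> K) \<and>
        (\<forall>l. Vector_Spaces.linear scaleC (*) l \<longrightarrow> (\<lambda>t. l (\<gamma> t)) holomorphic_on ball 0 R)"
proof -
  obtain S \<Lambda> W and g :: "'u \<Rightarrow> 'v" and W' h where "open S" "u \<in> S" "open \<Lambda>"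
    and g: "holomorphic_map_open W g" "S \<inter> M \<subseteq> W" "g ` (S \<inter> M) \<subseteq> \<Lambda>"
    and h: "holomorphic_map_open W' h" "\<Lambda> \<subseteq> W'" "h ` \<Lambda> \<subseteq> S \<inter> M"
    and hg: "\<And>x. x \<in> S \<inter> M \<Longrightarrow> h (g x) = x"
    by (rule complex_analytic_manifold_chartE[OF assms]) (rule that)
  have "u \<in> W" "g u \<in> \<Lambda>" "g u \<in> W'"
    using u \<open>u \<in> S\<close> g h by auto
  obtain r1 L1 where L1: "r1 > 0" "L1-lipschitz_on (ball u r1) g"
    using holomorphic_map_open_locally_lipschitz[OF g(1) \<open>u \<in> W\<close>] by blast
  obtain r2 L2 where L2: "r2 > 0" "L2-lipschitz_on (ball (g u) r2) h"
    using holomorphic_map_open_locally_lipschitz[OF h(1) \<open>g u \<in> W'\<close>] by blast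
  obtain r3 where r3: "r3 > 0" "ball (g u) r3 \<subseteq> \<Lambda>"
    using \<open>open \<Lambda>\<close> \<open>g u \<in> \<Lambda>\<close> open_contains_ball by blast
  obtain r4 where r4: "r4 > 0" "ball u r4 \<subseteq> S"
    using \<open>open S\<close> \<open>u \<in> S\<close> open_contains_ball by blast
  have nonneg: "L1 \<ge> 0" "L2 \<ge> 0"
    using L1 L2 by (auto simp: lipschitz_on_def)
  define \<rho> where "\<rho> = min r2 r3"
  define r where "r = min (min r1 r4) (\<rho> / (4 * (L1 + 1)))"
  have "\<rho> > 0"
    using L2 r3 by (simp add: \<rho>_def)
  then have "r > 0"
    using L1 r4 nonneg by (simp add: r_def)
  have near: "g x \<in> ball (g u) (\<rho> / 4)" if "x \<in> ball u r" for x
  proof -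
    have "dist (g u) (g x) \<le> L1 * dist u x"
      using that \<open>r > 0\<close> by (intro lipschitz_onD[OF L1(2)]) (auto simp: r_def)
    also have "\<dots> \<le> (L1 + 1) * dist u x"
      by (simp add: mult_right_mono)
    also have "\<dots> < (L1 + 1) * (\<rho> / (4 * (L1 + 1)))"
      using that nonneg by (intro mult_strict_left_mono) (auto simp: r_def)
    also have "\<dots> = \<rho> / 4"
      using nonneg by (simp add: field_simps)
    finally show ?thesis
      by simp
  qed
  have in_\<Lambda>: "ball (g u) \<rho> \<subseteq> \<Lambda>" "\<rho> \<le> r2"
    using r3(2) by (auto simp: \<rho>_def)
  show ?thesis
  proof (rule that[of r "2 * L1 / \<rho>" "L2 * \<rho>"])
    fix x y
    assume x: "x \<in> M \<inter> ball u r" and y: "y \<in> M \<inter> ball u r" and "x \<noteq> y"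
    have xyS: "x \<in> S \<inter> M" "y \<in> S \<inter> M"
      using x y r4(2) by (auto simp: r_def)
    have "g x \<noteq> g y"
      using hg[OF xyS(1)] hg[OF xyS(2)] \<open>x \<noteq> y\<close> by metis
    define R where "R = \<rho> / 2 / norm (g y - g x)"
    define p where "p t = g x + t *\<^sub>C (g y - g x)" for t
    have "norm (g y - g x) < \<rho> / 2"
      using dist_triangle_half_r[of "g u" "g y" "\<rho> / 2" "g x"] near[of x] near[of y] x y
      by (simp add: dist_norm)
    then have "R > 1"
      using \<open>g x \<noteq> g y\<close> by (simp add: R_def field_simps)
    have "norm (g y - g x) \<le> L1 * norm (y - x)"
      using x y lipschitz_onD[OF L1(2), of y x] by (simp add: r_def dist_norm)
    then have "1 / R \<le> 2 * L1 / \<rho> * norm (y - x)"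
      using \<open>\<rho> > 0\<close> by (simp add: R_def divide_right_mono)
    have small: "norm (t *\<^sub>C (g y - g x)) < \<rho> / 2" if "t \<in> ball 0 R" for t
      unfolding norm_scaleC using that \<open>g x \<noteq> g y\<close> by (simp add: R_def field_simps)
    have p: "p t \<in> ball (g u) \<rho>" if "t \<in> ball 0 R" for t
      using small[OF that] near[of x] x \<open>\<rho> > 0\<close> norm_triangle_ineq[of "g x - g u" "t *\<^sub>C (g y - g x)"]
      by (simp add: p_def dist_norm norm_minus_commute algebra_simps)
    have "norm (h (p t) - x) \<le> L2 * \<rho>" if "t \<in> ball 0 R" for t
    proof -
      have "norm (h (p t) - x) = dist (h (p t)) (h (g x))"
        by (simp add: dist_norm hg[OF xyS(1)])
      also have "\<dots> \<le> L2 * dist (p t) (g x)"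
        using p[OF that] near[of x] x in_\<Lambda>(2) \<open>\<rho> > 0\<close> by (intro lipschitz_onD[OF L2(2)]) auto
      also have "\<dots> \<le> L2 * \<rho>"
        using small[OF that] nonneg \<open>\<rho> > 0\<close> by (intro mult_left_mono) (auto simp: p_def dist_norm)
      finally show ?thesis .
    qed
    moreover have "h (p t) \<in> M" if "t \<in> ball 0 R" for t
      using p[OF that] in_\<Lambda>(1) h(3) by blast
    moreover have "(\<lambda>t. l (h (p t))) holomorphic_on ball 0 R"
      if "Vector_Spaces.linear scaleC (*) l" for l
    proof -
      have "ball 0 R \<subseteq> {t. p t \<in> W'}"
        using p in_\<Lambda>(1) h(2) by blast
      then show ?thesis
        unfolding p_def by (rule holomorphic_on_subset[OF holomorphic_map_open_on_line[OF h(1) that]])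
    qed
    moreover have "h (p 0) = x" "h (p 1) = y"
      using hg xyS by (simp_all add: p_def)
    ultimately show "\<exists>\<gamma> R. R > 1 \<and> 1 / R \<le> 2 * L1 / \<rho> * norm (y - x) \<and> \<gamma> 0 = x \<and> \<gamma> 1 = y \<and>
        (\<forall>t\<in>ball 0 R. \<gamma> t \<in> M \<and> norm (\<gamma> t - x) \<le> L2 * \<rho>) \<and>
        (\<forall>l. Vector_Spaces.linear scaleC (*) l \<longrightarrow> (\<lambda>t. l (\<gamma> t)) holomorphic_on ball 0 R)"
      using \<open>R > 1\<close> \<open>1 / R \<le> 2 * L1 / \<rho> * norm (y - x)\<close>
      by (intro exI[of _ "\<lambda>t. h (p t)"] exI[of _ R]) blast
  qed (rule \<open>r > 0\<close>)
qed

section \<open>Nearest points and holomorphic discs\<close>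

lemma is_projection_iff:
  "is_projection M b x \<longleftrightarrow> x \<in> M \<and> (\<forall>y\<in>M. norm (x - b) \<le> norm (y - b))"
proof -
  have "bdd_below ((\<lambda>y. norm (y - b)) ` M)"
    by (rule bdd_belowI2[of _ 0]) simp
  then have "(INF y\<in>M. norm (y - b)) \<le> norm (y - b)" if "y \<in> M" for y
    using that by (rule cINF_lower)
  moreover have "norm (x - b) = (INF y\<in>M. norm (y - b))"
    if "x \<in> M" "\<forall>y\<in>M. norm (x - b) \<le> norm (y - b)"
    using that by (intro cInf_eq_minimum[symmetric]) auto
  ultimately show ?thesis
    unfolding is_projection_def by metis
qed

text \<open>
  With \<open>w = b - \<gamma> 0\<close>, the real part of the holomorphic function \<open>f\<close> is \<open>w \<bullet> (\<gamma> t - \<gamma> 0)\<close>. The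
  nearest point property becomes \<open>2 * Re (t * q t) \<le> (norm (\<gamma> t - \<gamma> 0))\<^sup>2\<close>, where \<open>f t = t * q t\<close>. It
  forces \<open>q 0 = 0\<close>, because the direction of \<open>t\<close> in the complex plane is free.
\<close>
lemma nearest_point_disc_estimate:
  fixes \<gamma> :: "complex \<Rightarrow> complex ^ 'n"
  assumes hol: "\<And>i. (\<lambda>t. \<gamma> t $ i) holomorphic_on ball 0 R"
    and "R > 1" and bound: "\<And>t. t \<in> ball 0 R \<Longrightarrow> norm (\<gamma> t - \<gamma> 0) \<le> K"
    and nearest: "\<And>t. t \<in> ball 0 R \<Longrightarrow> norm (\<gamma> 0 - b) \<le> norm (\<gamma> t - b)"
  shows "(b - \<gamma> 0) \<bullet> (\<gamma> 1 - \<gamma> 0) \<le> norm (b - \<gamma> 0) * K * (1 / R)\<^sup>2"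
proof -
  define w where "w = b - \<gamma> 0"
  define f where "f t = (\<Sum>i\<in>UNIV. cnj (w $ i) * (\<gamma> t $ i - \<gamma> 0 $ i))" for t
  have Re_f: "Re (f t) = w \<bullet> (\<gamma> t - \<gamma> 0)" for t
    by (simp add: f_def inner_vec_def inner_complex_def)
  have "\<exists>h. h holomorphic_on ball 0 R \<and> (\<forall>t\<in>ball 0 R. \<gamma> t $ i - \<gamma> 0 $ i = t * h t)" for i
  proof -
    have holi: "(\<lambda>t. \<gamma> t $ i - \<gamma> 0 $ i) holomorphic_on ball 0 R"
      by (intro holomorphic_intros hol)
    obtain h where "h holomorphic_on ball 0 R"
        "\<And>t. norm t < R \<Longrightarrow> \<gamma> t $ i - \<gamma> 0 $ i = t * h t"
      by (rule Schwarz3[OF holi]) (use that in auto)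
    then show ?thesis
      by auto
  qed
  then have "\<exists>h. \<forall>i. h i holomorphic_on ball 0 R \<and>
      (\<forall>t\<in>ball 0 R. \<gamma> t $ i - \<gamma> 0 $ i = t * h i t)"
    by (intro choice allI)
  then obtain h where h_all: "\<forall>i. h i holomorphic_on ball 0 R \<and>
      (\<forall>t\<in>ball 0 R. \<gamma> t $ i - \<gamma> 0 $ i = t * h i t)" ..
  have h: "h i holomorphic_on ball 0 R"
    and h_eq: "t \<in> ball 0 R \<Longrightarrow> \<gamma> t $ i - \<gamma> 0 $ i = t * h i t" for i t
    using h_all by blast+
  define q where "q t = (\<Sum>i\<in>UNIV. cnj (w $ i) * h i t)" for t
  have f_q: "f t = t * q t" if "t \<in> ball 0 R" for t
    using h_eq[OF that] by (simp add: f_def q_def sum_distrib_left mult_ac)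
  have contq: "isCont q 0" and conth: "isCont (\<lambda>t. \<Sum>i\<in>UNIV. (cmod (h i t))\<^sup>2) 0"
  proof -
    have "isCont (h i) 0" for i
      using holomorphic_on_imp_continuous_on[OF h] \<open>R > 1\<close>
      by (simp add: continuous_on_eq_continuous_at)
    then show "isCont q 0" "isCont (\<lambda>t. \<Sum>i\<in>UNIV. (cmod (h i t))\<^sup>2) 0"
      unfolding q_def[abs_def] by (intro continuous_intros; simp)+
  qed
  have norm_\<gamma>: "(norm (\<gamma> t - \<gamma> 0))\<^sup>2 = (cmod t)\<^sup>2 * (\<Sum>i\<in>UNIV. (cmod (h i t))\<^sup>2)"
    if "t \<in> ball 0 R" for t
    using h_eq[OF that]
    by (simp add: norm_vec_def L2_set_def sum_nonneg norm_mult power_mult_distrib sum_distrib_left)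
  have Re_le: "2 * Re (f t) \<le> (norm (\<gamma> t - \<gamma> 0))\<^sup>2" if "t \<in> ball 0 R" for t
  proof -
    have "(norm w)\<^sup>2 \<le> (norm ((\<gamma> t - \<gamma> 0) - w))\<^sup>2"
      using nearest[OF that] by (intro power_mono) (auto simp: w_def norm_minus_commute)
    then show ?thesis
      by (simp add: Re_f power2_norm_eq_inner inner_diff_left inner_diff_right inner_commute)
  qed
  \<comment> \<open>For \<open>t = s * cnj c\<close> with small real \<open>s > 0\<close>, the left-hand side is close to
    \<open>2 * s * (cmod c)\<^sup>2\<close>, whereas the right-hand side is of order \<open>s\<^sup>2\<close>;
    divide by \<open>s\<close> and let \<open>s\<close> tend to \<open>0\<close>.\<close>
  define c where "c = q 0"
  have "q 0 = 0"
  proof -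
    have ev: "\<forall>\<^sub>F s in at_right (0 :: real). 2 * Re (cnj c * q (of_real s * cnj c))
        \<le> s * (cmod c)\<^sup>2 * (\<Sum>i\<in>UNIV. (cmod (h i (of_real s * cnj c)))\<^sup>2)"
    proof -
      have "((\<lambda>s. cmod (of_real s * cnj c)) \<longlongrightarrow> cmod (of_real 0 * cnj c)) (at_right 0)"
        by (intro tendsto_intros)
      then have "\<forall>\<^sub>F s in at_right 0. cmod (of_real s * cnj c) < R"
        by (rule order_tendstoD(2)) (use \<open>R > 1\<close> in simp)
      moreover have "\<forall>\<^sub>F s in at_right (0 :: real). s > 0"
        by (rule eventually_at_right_less)
      ultimately show ?thesis
      proof eventually_elim
        case (elim s)
        then have t: "of_real s * cnj c \<in> ball 0 R"
          by simp
        have "s * (2 * Re (cnj c * q (of_real s * cnj c)))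
            = 2 * Re (f (of_real s * cnj c))"
          unfolding f_q[OF t] by (simp add: algebra_simps)
        also have "\<dots> \<le> s * (s * (cmod c)\<^sup>2 * (\<Sum>i\<in>UNIV. (cmod (h i (of_real s * cnj c)))\<^sup>2))"
          using Re_le[OF t] unfolding norm_\<gamma>[OF t]
          by (simp add: norm_mult power_mult_distrib power2_eq_square mult_ac)
        finally show ?case
          using \<open>s > 0\<close> by simp
      qed
    qed
    have lim: "((\<lambda>s. of_real s * cnj c) \<longlongrightarrow> 0) (at_right (0 :: real))"
      by (rule tendsto_eq_intros refl | simp)+
    have "2 * Re (cnj c * q 0) \<le> 0 * (cmod c)\<^sup>2 * (\<Sum>i\<in>UNIV. (cmod (h i 0))\<^sup>2)"
      by (rule tendsto_le[OF _ _ _ ev])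
        (intro tendsto_intros isCont_tendsto_compose[OF contq lim]
          isCont_tendsto_compose[OF conth lim] trivial_limit_at_right_real; fail)+
    then show ?thesis
      by (simp add: c_def mult.commute[of "cnj _"] complex_mult_cnj flip: cmod_power2)
  qed
  have holq: "q holomorphic_on ball 0 R"
    unfolding q_def[abs_def] by (intro holomorphic_intros h)
  have bound_f: "cmod (f t) \<le> norm w * K" if "t \<in> ball 0 R" for t
  proof -
    have "cmod (f t) \<le> (\<Sum>i\<in>UNIV. \<bar>cmod (w $ i)\<bar> * \<bar>cmod ((\<gamma> t - \<gamma> 0) $ i)\<bar>)"
      unfolding f_def by (rule order_trans[OF norm_sum]) (simp add: norm_mult)
    also have "\<dots> \<le> norm w * norm (\<gamma> t - \<gamma> 0)"
      unfolding norm_vec_def by (rule L2_set_mult_ineq)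
    also have "\<dots> \<le> norm w * K"
      by (intro mult_left_mono bound that) simp
    finally show ?thesis .
  qed
  have "cmod (1 * q 1) \<le> norm w * K * (cmod 1 / R)\<^sup>2"
    by (rule schwarz_second_order[OF holq \<open>q 0 = 0\<close>])
      (use bound_f f_q \<open>R > 1\<close> in auto)
  then have "cmod (f 1) \<le> norm w * K * (1 / R)\<^sup>2"
    using f_q[of 1] \<open>R > 1\<close> by simp
  then show ?thesis
    using Re_f[of 1] complex_Re_le_cmod[of "f 1"] by (simp add: w_def)
qed

section \<open>Tubular neighborhoods in Euclidean space\<close>

text \<open>
  The Lipschitz bound speaks of arbitrary nearest points rather than of a projection map: in the proof
  its case \<open>b1 = b2\<close> yields uniqueness, and it carries over to isometric images without any mention
  of definite descriptions.
\<close>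
lemma tubular_neighborhood_if_quadratic_estimate:
  fixes N :: "'a::euclidean_space set"
  assumes local: "\<And>u. u \<in> N \<Longrightarrow> \<exists>r>0. \<exists>C. closed (N \<inter> cball u r) \<and>
      (\<forall>x\<in>N \<inter> ball u r. \<forall>y\<in>N \<inter> ball u r. \<forall>b. is_projection N b x \<longrightarrow>
        (b - x) \<bullet> (y - x) \<le> C * norm (b - x) * (norm (y - x))\<^sup>2)"
  obtains \<Omega> where "open \<Omega>" "N \<subseteq> \<Omega>" "\<And>b. b \<in> \<Omega> \<Longrightarrow> \<exists>!x. is_projection N b x"
    "\<And>b. b \<in> \<Omega> \<Longrightarrow> \<exists>\<epsilon>>0. \<forall>b1 b2 x1 x2. b1 \<in> ball b \<epsilon> \<longrightarrow> b2 \<in> ball b \<epsilon> \<longrightarrow>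
      is_projection N b1 x1 \<longrightarrow> is_projection N b2 x2 \<longrightarrow> dist x1 x2 \<le> 2 * dist b1 b2"
proof -
  have "\<exists>\<delta>>0. (\<forall>b\<in>ball u \<delta>. \<exists>x. is_projection N b x) \<and>
      (\<forall>b1\<in>ball u \<delta>. \<forall>b2\<in>ball u \<delta>. \<forall>x1 x2. is_projection N b1 x1 \<longrightarrow>
        is_projection N b2 x2 \<longrightarrow> dist x1 x2 \<le> 2 * dist b1 b2)" if u: "u \<in> N" for u
  proof -
    obtain r C where "r > 0" and closed: "closed (N \<inter> cball u r)"
      and est: "\<And>x y b. x \<in> N \<inter> ball u r \<Longrightarrow> y \<in> N \<inter> ball u r \<Longrightarrow> is_projection N b x \<Longrightarrow>
        (b - x) \<bullet> (y - x) \<le> C * norm (b - x) * (norm (y - x))\<^sup>2"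
      using local[OF u] by blast
    \<comment> \<open>The bound \<open>r / 2\<close> keeps nearest points inside \<open>ball u r\<close>; the other bound
      makes \<open>C * norm (b - x)\<close> at most \<open>1 / 4\<close>, and adding \<open>1\<close> to \<open>\<bar>C\<bar>\<close>
      avoids a zero denominator.\<close>
    define \<delta> where "\<delta> = min (r / 2) (1 / (4 * (\<bar>C\<bar> + 1)))"
    have "\<delta> > 0"
      using \<open>r > 0\<close> by (simp add: \<delta>_def)
    have ex: "\<exists>x. is_projection N b x" if b: "b \<in> ball u \<delta>" for b
    proof -
      have "compact (N \<inter> cball u r)"
        using closed by (simp add: compact_eq_bounded_closed bounded_Int)
      moreover have "N \<inter> cball u r \<noteq> {}"
        using u \<open>r > 0\<close> by auto
      ultimately obtain x where x: "x \<in> N \<inter> cball u r"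
          "\<And>y. y \<in> N \<inter> cball u r \<Longrightarrow> norm (x - b) \<le> norm (y - b)"
        using continuous_attains_inf[of "N \<inter> cball u r" "\<lambda>x. norm (x - b)"]
        by (force intro!: continuous_intros)
      have "norm (x - b) \<le> norm (y - b)" if "y \<in> N" for y
      proof (cases "y \<in> cball u r")
        case False
        have "norm (x - b) \<le> norm (u - b)"
          using x(2)[of u] u \<open>r > 0\<close> by simp
        also have "\<dots> \<le> norm (y - b)"
          using False b dist_triangle[of u y b] by (simp add: dist_norm norm_minus_commute \<delta>_def)
        finally show ?thesis .
      qed (use x(2) that in simp)
      then show ?thesis
        using x(1) is_projection_iff by blast
    qed
    have near: "x \<in> N \<inter> ball u r" "norm (b - x) < \<delta>"
      if "b \<in> ball u \<delta>" "is_projection N b x" for b x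
    proof -
      have "norm (x - b) \<le> norm (u - b)" "x \<in> N"
        using that(2) u by (auto simp: is_projection_iff)
      then show "norm (b - x) < \<delta>"
        using that(1) by (simp add: dist_norm norm_minus_commute)
      then show "x \<in> N \<inter> ball u r"
        using \<open>x \<in> N\<close> that(1) dist_triangle[of u x b] by (simp add: dist_norm \<delta>_def)
    qed
    have quarter: "(b - x) \<bullet> (y - x) \<le> 1 / 4 * (norm (y - x))\<^sup>2"
      if b: "b \<in> ball u \<delta>" and x: "is_projection N b x" and y: "y \<in> N \<inter> ball u r" for b x y
    proof -
      have "C * norm (b - x) \<le> (\<bar>C\<bar> + 1) * norm (b - x)"
        by (intro mult_right_mono) auto
      also have "\<dots> \<le> (\<bar>C\<bar> + 1) * (1 / (4 * (\<bar>C\<bar> + 1)))"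
        using near(2)[OF b x] by (intro mult_left_mono) (auto simp: \<delta>_def)
      also have "\<dots> = 1 / 4"
        by (simp add: field_simps)
      finally have "C * norm (b - x) * (norm (y - x))\<^sup>2 \<le> 1 / 4 * (norm (y - x))\<^sup>2"
        by (rule mult_right_mono) simp
      then show ?thesis
        using est[OF near(1)[OF b x] y x] by simp
    qed
    have "dist x1 x2 \<le> 2 * dist b1 b2"
      if b: "b1 \<in> ball u \<delta>" "b2 \<in> ball u \<delta>"
        and x: "is_projection N b1 x1" "is_projection N b2 x2" for b1 b2 x1 x2
    proof -
      have "(b1 - x1) \<bullet> (x2 - x1) \<le> 1 / 4 * (norm (x2 - x1))\<^sup>2"
        by (rule quarter[OF b(1) x(1) near(1)[OF b(2) x(2)]])
      moreover have "(b2 - x2) \<bullet> (x1 - x2) \<le> 1 / 4 * (norm (x2 - x1))\<^sup>2"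
        using quarter[OF b(2) x(2) near(1)[OF b(1) x(1)]] by (simp add: norm_minus_commute)
      ultimately have "(norm (x2 - x1))\<^sup>2 \<le> 2 * ((b2 - b1) \<bullet> (x2 - x1))"
        by (simp add: power2_norm_eq_inner algebra_simps inner_commute)
      also have "\<dots> \<le> 2 * norm (b2 - b1) * norm (x2 - x1)"
        using norm_cauchy_schwarz[of "b2 - b1" "x2 - x1"] by simp
      finally show ?thesis
        by (cases "x1 = x2") (auto simp: power2_eq_square dist_norm norm_minus_commute)
    qed
    then show ?thesis
      using ex \<open>\<delta> > 0\<close> by blast
  qed
  then obtain \<delta> where \<delta>: "\<And>u. u \<in> N \<Longrightarrow> \<delta> u > 0"
    "\<And>u b. u \<in> N \<Longrightarrow> b \<in> ball u (\<delta> u) \<Longrightarrow> \<exists>x. is_projection N b x"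
    "\<And>u b1 b2 x1 x2. u \<in> N \<Longrightarrow> b1 \<in> ball u (\<delta> u) \<Longrightarrow> b2 \<in> ball u (\<delta> u) \<Longrightarrow>
      is_projection N b1 x1 \<Longrightarrow> is_projection N b2 x2 \<Longrightarrow> dist x1 x2 \<le> 2 * dist b1 b2"
    by metis
  show ?thesis
  proof (rule that[of "\<Union>u\<in>N. ball u (\<delta> u)"])
    show "N \<subseteq> (\<Union>u\<in>N. ball u (\<delta> u))"
      using \<delta>(1) by force
  next
    fix b
    assume "b \<in> (\<Union>u\<in>N. ball u (\<delta> u))"
    then obtain u where u: "u \<in> N" "b \<in> ball u (\<delta> u)"
      by blast
    have "x1 = x2" if "is_projection N b x1" "is_projection N b x2" for x1 x2
      using \<delta>(3)[OF u u(2) that] by simp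
    then show "\<exists>!x. is_projection N b x"
      using \<delta>(2)[OF u] by blast
    obtain \<epsilon> where "\<epsilon> > 0" "ball b \<epsilon> \<subseteq> ball u (\<delta> u)"
      using u(2) open_contains_ball open_ball by blast
    then show "\<exists>\<epsilon>>0. \<forall>b1 b2 x1 x2. b1 \<in> ball b \<epsilon> \<longrightarrow> b2 \<in> ball b \<epsilon> \<longrightarrow>
        is_projection N b1 x1 \<longrightarrow> is_projection N b2 x2 \<longrightarrow> dist x1 x2 \<le> 2 * dist b1 b2"
      using \<delta>(3)[OF u(1)] by (intro exI[of _ \<epsilon>]) blast
  qed auto
qed

section \<open>Transport along the isometry\<close>

lemma isometric_isomorphism_properties:
  fixes T :: "'u::complex_normed_vector \<Rightarrow> complex ^ 'n::finite"
  assumes "isometric_isomorphism T"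
  shows "bij T" "T x - T y = T (x - y)" "norm (T x) = norm x" "dist (T x) (T y) = dist x y"
    "Vector_Spaces.linear scaleC (*) (\<lambda>x. T x $ i)"
proof -
  interpret T: Vector_Spaces.linear scaleC scaleC T
    using assms by (simp add: isometric_isomorphism_def)
  show "bij T" and norm: "norm (T x) = norm x" for x
    using assms by (auto simp: isometric_isomorphism_def)
  show diff: "T x - T y = T (x - y)" for x y
    by (simp add: T.diff)
  show "dist (T x) (T y) = dist x y"
    by (simp add: dist_norm diff norm)
  show "Vector_Spaces.linear scaleC (*) (\<lambda>x. T x $ i)"
    by unfold_locales
      (simp_all add: T.add T.scale scaleC_vec_def scaleC_complex_def algebra_simps)
qed

lemma is_projection_isometric_image:
  fixes T :: "'u::complex_normed_vector \<Rightarrow> complex ^ 'n::finite"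
  assumes "isometric_isomorphism T"
  shows "is_projection (T ` M) (T b) (T x) \<longleftrightarrow> is_projection M b x"
proof -
  have "T x \<in> T ` M \<longleftrightarrow> x \<in> M"
    using isometric_isomorphism_properties(1)[OF assms] by (simp add: bij_is_inj inj_image_mem_iff)
  then show ?thesis
    by (simp add: is_projection_iff isometric_isomorphism_properties(2,3)[OF assms])
qed

lemma closed_isometric_image:
  fixes T :: "'u::complex_normed_vector \<Rightarrow> complex ^ 'n::finite"
  assumes T: "isometric_isomorphism T" and "closed A"
  shows "closed (T ` A)"
proof -
  note bij = isometric_isomorphism_properties(1)[OF T]
  have "1-lipschitz_on UNIV (inv T)"
    using isometric_isomorphism_properties(4)[OF T, of "inv T _" "inv T _"]
    by (intro lipschitz_onI) (simp_all add: bij_is_surj[OF bij] surj_f_inv_f)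
  then have "closed (inv T -` A)"
    using \<open>closed A\<close> by (intro closed_vimage lipschitz_on_continuous_on)
  then show ?thesis
    by (simp add: bij_vimage_eq_inv_image[OF bij_imp_bij_inv[OF bij]] inv_inv_eq[OF bij])
qed

lemma isometric_manifold_quadratic_estimate:
  fixes M :: "'u::complex_normed_vector set" and T :: "'u \<Rightarrow> complex ^ 'n::finite"
  assumes T: "isometric_isomorphism T"
    and M: "complex_analytic_manifold TYPE('v::complex_normed_vector) m M" and v: "v \<in> T ` M"
  shows "\<exists>r>0. \<exists>C. closed (T ` M \<inter> cball v r) \<and>
      (\<forall>x\<in>T ` M \<inter> ball v r. \<forall>y\<in>T ` M \<inter> ball v r. \<forall>b. is_projection (T ` M) b x \<longrightarrow>
        (b - x) \<bullet> (y - x) \<le> C * norm (b - x) * (norm (y - x))\<^sup>2)"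
proof -
  note T_simps = isometric_isomorphism_properties(2-4)[OF T]
  obtain u where u: "u \<in> M" "v = T u"
    using v by blast
  obtain r1 where r1: "r1 > 0" "closed (M \<inter> cball u r1)"
    by (rule complex_analytic_manifold_locally_closed[OF M u(1)])
  obtain r2 K L where r2: "r2 > 0"
    and disc: "\<And>x y. x \<in> M \<inter> ball u r2 \<Longrightarrow> y \<in> M \<inter> ball u r2 \<Longrightarrow> x \<noteq> y \<Longrightarrow>
      \<exists>\<gamma> R. R > 1 \<and> 1 / R \<le> L * norm (y - x) \<and> \<gamma> 0 = x \<and> \<gamma> 1 = y \<and>
        (\<forall>t\<in>ball 0 R. \<gamma> t \<in> M \<and> norm (\<gamma> t - x) \<le> K) \<and>
        (\<forall>l. Vector_Spaces.linear scaleC (*) l \<longrightarrow> (\<lambda>t. l (\<gamma> t)) holomorphic_on ball 0 R)"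
    by (rule complex_analytic_manifold_discs[OF M u(1)]) (rule that)
  define r where "r = min r1 r2"
  have "M \<inter> cball u r = (M \<inter> cball u r1) \<inter> cball u r"
    by (auto simp: r_def)
  then have "closed (M \<inter> cball u r)"
    using r1(2) closed_Int[OF _ closed_cball] by metis
  moreover have "T ` (M \<inter> cball u r) = T ` M \<inter> cball v r"
    by (auto simp: u(2) T_simps)
  ultimately have closed: "closed (T ` M \<inter> cball v r)"
    using closed_isometric_image[OF T] by metis
  have "(b - x) \<bullet> (y - x) \<le> K * L\<^sup>2 * norm (b - x) * (norm (y - x))\<^sup>2"
    if x: "x \<in> T ` M \<inter> ball v r" and y: "y \<in> T ` M \<inter> ball v r"
      and proj: "is_projection (T ` M) b x" for x y b
  proof (cases "x = y")
    case False
    obtain x' y' where x': "x = T x'" "x' \<in> M \<inter> ball u r2" and y': "y = T y'" "y' \<in> M \<inter> ball u r2"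
      using x y by (auto simp: u(2) T_simps r_def)
    have "x' \<noteq> y'"
      using False x'(1) y'(1) by blast
    from disc[OF x'(2) y'(2) this] obtain \<gamma> R where "R > 1" and R: "1 / R \<le> L * norm (y' - x')"
      and \<gamma>: "\<gamma> 0 = x'" "\<gamma> 1 = y'"
      and in_M: "\<And>t. t \<in> ball 0 R \<Longrightarrow> \<gamma> t \<in> M"
      and K: "\<And>t. t \<in> ball 0 R \<Longrightarrow> norm (\<gamma> t - x') \<le> K"
      and hol: "\<And>l. Vector_Spaces.linear scaleC (*) l \<Longrightarrow> (\<lambda>t. l (\<gamma> t)) holomorphic_on ball 0 R"
      by blast
    have "K \<ge> 0"
      using K[of 0] \<open>R > 1\<close> \<gamma>(1) by simp
    have "(b - T (\<gamma> 0)) \<bullet> (T (\<gamma> 1) - T (\<gamma> 0)) \<le> norm (b - T (\<gamma> 0)) * K * (1 / R)\<^sup>2"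
    proof (rule nearest_point_disc_estimate[of "\<lambda>t. T (\<gamma> t)"])
      show "(\<lambda>t. T (\<gamma> t) $ i) holomorphic_on ball 0 R" for i
        by (rule hol[OF isometric_isomorphism_properties(5)[OF T]])
      show "norm (T (\<gamma> t) - T (\<gamma> 0)) \<le> K" if "t \<in> ball 0 R" for t
        using K[OF that] by (simp add: T_simps \<gamma>(1))
      show "norm (T (\<gamma> 0) - b) \<le> norm (T (\<gamma> t) - b)" if "t \<in> ball 0 R" for t
        using proj in_M[OF that] by (simp add: is_projection_iff \<gamma>(1) x'(1))
    qed (rule \<open>R > 1\<close>)
    also have "\<dots> \<le> norm (b - T (\<gamma> 0)) * K * (L * norm (y' - x'))\<^sup>2"
      using R \<open>R > 1\<close> \<open>K \<ge> 0\<close> by (intro mult_left_mono power_mono) auto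
    finally show ?thesis
      by (simp add: \<gamma> x'(1) y'(1) T_simps power_mult_distrib mult_ac)
  qed simp
  then show ?thesis
    using closed r1(1) r2 by (intro exI[of _ r] conjI exI[of _ "K * L\<^sup>2"]) (auto simp: r_def)
qed

theorem theorem3:
  fixes M :: "'u::complex_normed_vector set"
    and T :: "'u \<Rightarrow> complex ^ 'n::finite"
    and m :: nat
  assumes "isometric_isomorphism T"
    and "complex_analytic_manifold TYPE('v::complex_normed_vector) m M"
  shows "\<exists>\<Omega>. open \<Omega> \<and> M \<subseteq> \<Omega> \<and>
           (\<forall>b\<in>\<Omega>. \<exists>!x. is_projection M b x) \<and>
           locally_lipschitz_on \<Omega> (\<lambda>b. THE x. is_projection M b x)"
proof -
  note bij = isometric_isomorphism_properties(1)[OF assms(1)]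
  note dist_T = isometric_isomorphism_properties(4)[OF assms(1)]
  note proj_T = is_projection_isometric_image[OF assms(1)]
  obtain \<Omega> where \<Omega>: "open \<Omega>" "T ` M \<subseteq> \<Omega>"
    and unique: "\<And>b. b \<in> \<Omega> \<Longrightarrow> \<exists>!x. is_projection (T ` M) b x"
    and lipschitz: "\<And>b. b \<in> \<Omega> \<Longrightarrow> \<exists>\<epsilon>>0. \<forall>b1 b2 x1 x2. b1 \<in> ball b \<epsilon> \<longrightarrow> b2 \<in> ball b \<epsilon> \<longrightarrow>
      is_projection (T ` M) b1 x1 \<longrightarrow> is_projection (T ` M) b2 x2 \<longrightarrow> dist x1 x2 \<le> 2 * dist b1 b2"
    by (rule tubular_neighborhood_if_quadratic_estimate
        [OF isometric_manifold_quadratic_estimate[OF assms]]) (assumption | rule that)+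
  have unique': "\<exists>!x. is_projection M b x" if b: "b \<in> T -` \<Omega>" for b
  proof -
    obtain z where z: "is_projection (T ` M) (T b) z" "\<And>z'. is_projection (T ` M) (T b) z' \<Longrightarrow> z' = z"
      using unique[of "T b"] b by auto
    obtain x where "z = T x"
      using bij_is_surj[OF bij] by blast
    then show ?thesis
      using z proj_T bij_is_inj[OF bij] by (metis injD)
  qed
  have "1-lipschitz_on UNIV T"
    by (rule lipschitz_onI) (simp_all add: dist_T)
  then have "open (T -` \<Omega>)"
    using \<Omega>(1) by (intro open_vimage lipschitz_on_continuous_on)
  moreover have "M \<subseteq> T -` \<Omega>"
    using \<Omega>(2) by blast
  moreover have "locally_lipschitz_on (T -` \<Omega>) (\<lambda>b. THE x. is_projection M b x)"
    unfolding locally_lipschitz_on_def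
  proof
    fix b
    assume "b \<in> T -` \<Omega>"
    then obtain \<epsilon> where "\<epsilon> > 0" and \<epsilon>: "\<And>b1 b2 x1 x2. T b1 \<in> ball (T b) \<epsilon> \<Longrightarrow> T b2 \<in> ball (T b) \<epsilon> \<Longrightarrow>
        is_projection (T ` M) (T b1) (T x1) \<Longrightarrow> is_projection (T ` M) (T b2) (T x2) \<Longrightarrow>
        dist (T x1) (T x2) \<le> 2 * dist (T b1) (T b2)"
      using lipschitz[of "T b"] by (metis vimageD)
    have "2-lipschitz_on (ball b \<epsilon> \<inter> T -` \<Omega>) (\<lambda>b. THE x. is_projection M b x)"
    proof (rule lipschitz_onI)
      fix b1 b2
      assume "b1 \<in> ball b \<epsilon> \<inter> T -` \<Omega>" "b2 \<in> ball b \<epsilon> \<inter> T -` \<Omega>"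
      then show "dist (THE x. is_projection M b1 x) (THE x. is_projection M b2 x) \<le> 2 * dist b1 b2"
        using \<epsilon>[of b1 b2, unfolded proj_T dist_T] theI'[OF unique'[of b1]] theI'[OF unique'[of b2]]
        by (simp add: dist_T)
    qed simp
    then show "\<exists>\<epsilon>>0. \<exists>L. L-lipschitz_on (ball b \<epsilon> \<inter> T -` \<Omega>) (\<lambda>b. THE x. is_projection M b x)"
      using \<open>\<epsilon> > 0\<close> by blast
  qed
  ultimately show ?thesis
    using unique' by (intro exI[of _ "T -` \<Omega>"] conjI ballI)
qed

end
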